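(* For every integer $c\ge2$, the integrality gap of the LP relaxation below for MSSC on $c$-uniform hypergraphs is at least $\left(\frac{2c}{c+1}\right)^2$: that is, for every $\varepsilon>0$ there is a $c$-uniform hypergraph $H$ whose optimal MSSC value is at least $\left(\left(\frac{2c}{c+1}\right)^2-\varepsilon\right)$ times the optimal value of the LP for $H$.
   Context: A hypergraph is $c$-uniform if each hyperedge contains exactly $c$ vertices. MSSC on $H=(V,E)$: find a bijection $\sigma:V\to[n]$, $n=|V|$, minimizing $\sum_{e\in E}\min_{v\in e}\sigma(v)$. LP: variables $x_{v,t}\ge0$ ($v\in V$, $t\in[n]$), $u_{e,t}\ge0$ ($e\in E$, $t\in[n]$); minimize $\sum_{t,e}t\,u_{e,t}$ subject to $\sum_{v\in e}x_{v,t}-u_{e,t}\ge0$ for all $t,e$; $\sum_t u_{e,t}=1$ for all $e$; $\sum_v x_{v,t}=1$ for all $t$. *)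

theory Defs
  imports Complex_Main
begin

definition uniform_hypergraph :: "nat \<Rightarrow> nat set \<Rightarrow> nat set set \<Rightarrow> bool" where
  "uniform_hypergraph c V E \<longleftrightarrow> finite V \<and> (\<forall>e\<in>E. e \<subseteq> V \<and> card e = c)"

definition mssc_cost :: "nat set set \<Rightarrow> (nat \<Rightarrow> nat) \<Rightarrow> real" where
  "mssc_cost E \<sigma> = (\<Sum>e\<in>E. real (Min (\<sigma> ` e)))"

definition mssc_opt :: "nat set \<Rightarrow> nat set set \<Rightarrow> real" where
  "mssc_opt V E = Inf {mssc_cost E \<sigma> | \<sigma>. bij_betw \<sigma> V {1..card V}}"

definition lp_feasible :: "nat set \<Rightarrow> nat set set \<Rightarrow> (nat \<Rightarrow> nat \<Rightarrow> real) \<Rightarrow> (nat set \<Rightarrow> nat \<Rightarrow> real) \<Rightarrow> bool" where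
  "lp_feasible V E x u \<longleftrightarrow>
     (\<forall>v\<in>V. \<forall>t\<in>{1..card V}. x v t \<ge> 0) \<and>
     (\<forall>e\<in>E. \<forall>t\<in>{1..card V}. u e t \<ge> 0) \<and>
     (\<forall>e\<in>E. \<forall>t\<in>{1..card V}. (\<Sum>v\<in>e. x v t) - u e t \<ge> 0) \<and>
     (\<forall>e\<in>E. (\<Sum>t\<in>{1..card V}. u e t) = 1) \<and>
     (\<forall>t\<in>{1..card V}. (\<Sum>v\<in>V. x v t) = 1)"

definition lp_obj :: "nat set \<Rightarrow> nat set set \<Rightarrow> (nat set \<Rightarrow> nat \<Rightarrow> real) \<Rightarrow> real" where
  "lp_obj V E u = (\<Sum>t\<in>{1..card V}. \<Sum>e\<in>E. real t * u e t)"

definition lp_opt :: "nat set \<Rightarrow> nat set set \<Rightarrow> real" where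
  "lp_opt V E = Inf {lp_obj V E u | x u. lp_feasible V E x u}"

end

(*
  The hypergraph is a disjoint union of complete c-uniform hypergraphs ("cliques") whose sizes
  follow a power law: clique i has about B * i^(-2/(c+1)) vertices.

  Integral side: if w(v) is the number of edges first covered by v, the cost of an ordering is the
  sum of sigma(v) * w(v). Within a clique of size n these weights are C(0,c-1), ..., C(n-1,c-1) in
  some order, whatever the ordering is. Since 2 * sum_v sigma(v) w(v) is at least
  sum_{v,v'} min (w v) (w v'), the optimum is bounded below by a sum over pairs of cliques.

  Fractional side: the LP covers a clique of size n uniformly in n/c time steps, so it can process
  the cliques one after the other in order of decreasing size.

  Put k = (c-1)/(c+1), A = sum_i p_i^c * sum_{j<i} p_j with p_i = i^(k-1), and let H be the harmonic
  sum. Up to bounded terms and a common factor, the integral cost is c * (A - k * H), the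
  fractional cost is A, and H <= k * A. Hence the ratio tends to c * (1 - k^2) = (2c/(c+1))^2 as the
  number of cliques grows, the sizes being scaled to infinity first (B -> infinity).
*)

theory Submission
  imports Defs "HOL-Analysis.Summation_Tests" "HOL-Library.Disjoint_Sets" "HOL-Library.Nat_Bijection"
begin

section \<open>Subsets of fixed size and binomial sums over ranks\<close>

definition k_subsets :: "'a set \<Rightarrow> nat \<Rightarrow> 'a set set" where
  "k_subsets A k = {e. e \<subseteq> A \<and> card e = k}"

lemma finite_k_subsets: "finite A \<Longrightarrow> finite (k_subsets A k)"
  by (rule finite_subset[of _ "Pow A"]) (auto simp: k_subsets_def)

lemma k_subsets_insert:
  assumes "finite A" "b \<notin> A"
  shows "k_subsets (insert b A) (Suc k) = k_subsets A (Suc k) \<union> insert b ` k_subsets A k"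
proof (intro equalityI subsetI)
  fix e assume e: "e \<in> k_subsets (insert b A) (Suc k)"
  hence fin: "finite e" using assms by (auto simp: k_subsets_def intro: finite_subset)
  show "e \<in> k_subsets A (Suc k) \<union> insert b ` k_subsets A k"
  proof (cases "b \<in> e")
    case True
    hence "e = insert b (e - {b})" by auto
    moreover have "e - {b} \<in> k_subsets A k"
      using e fin True by (auto simp: k_subsets_def)
    ultimately show ?thesis by blast
  qed (use e in \<open>auto simp: k_subsets_def\<close>)
next
  fix e assume "e \<in> k_subsets A (Suc k) \<union> insert b ` k_subsets A k"
  thus "e \<in> k_subsets (insert b A) (Suc k)"
    using assms by (auto simp: k_subsets_def card_insert_if finite_subset)
qed

text \<open>Group the subsets by their minimum: those with minimum \<open>a\<close> arise by
  choosing the other \<open>k\<close> elements above \<open>a\<close>. The size \<open>Suc k\<close>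
  keeps \<open>Min\<close> away from the empty set.\<close>

lemma sum_Min_k_subsets:
  fixes A :: "nat set"
  assumes "finite A"
  shows "(\<Sum>e\<in>k_subsets A (Suc k). Min e) = (\<Sum>a\<in>A. a * (card {b\<in>A. b > a} choose k))"
  using assms
proof (induction A rule: finite_linorder_min_induct)
  case empty
  show ?case by (auto simp: k_subsets_def intro!: sum.neutral)
next
  case (insert b A)
  have b: "b \<notin> A" using insert by auto
  have inj: "inj_on (insert b) (k_subsets A k)"
    using b by (auto simp: inj_on_def k_subsets_def)
  have "(\<Sum>e\<in>k_subsets (insert b A) (Suc k). Min e)
      = (\<Sum>e\<in>k_subsets A (Suc k). Min e) + (\<Sum>e\<in>insert b ` k_subsets A k. Min e)"
    unfolding k_subsets_insert[OF insert.hyps(1) b]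
    by (rule sum.union_disjoint) (use insert b in \<open>auto simp: finite_k_subsets, auto simp: k_subsets_def\<close>)
  also have "(\<Sum>e\<in>insert b ` k_subsets A k. Min e) = (\<Sum>e\<in>k_subsets A k. b)"
    unfolding sum.reindex[OF inj] o_def
  proof (rule sum.cong[OF refl])
    fix e assume "e \<in> k_subsets A k"
    thus "Min (insert b e) = b"
      using insert.hyps by (intro Min_eqI) (auto simp: k_subsets_def intro: finite_subset less_imp_le)
  qed
  also have "\<dots> = b * (card A choose k)"
    using n_subsets[OF insert.hyps(1), of k] by (simp add: k_subsets_def)
  also have "card A = card {a\<in>insert b A. a > b}"
    using insert.hyps by (intro arg_cong[where f = card]) auto
  also have "(\<Sum>e\<in>k_subsets A (Suc k). Min e) = (\<Sum>a\<in>A. a * (card {b'\<in>insert b A. b' > a} choose k))"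
    unfolding insert.IH
    by (intro sum.cong refl arg_cong[where f = "\<lambda>X. _ * (card X choose k)"]) (use insert.hyps in force)
  finally show ?case using insert.hyps(1) b by simp
qed

text \<open>The number of larger elements takes each value below \<open>card A\<close> exactly once.
  Hence the weights inside a clique do not depend on the positions that it occupies.\<close>

lemma sum_rank:
  fixes A :: "nat set" and h :: "nat \<Rightarrow> 'b :: comm_monoid_add"
  assumes "finite A"
  shows "(\<Sum>a\<in>A. h (card {b\<in>A. b > a})) = (\<Sum>k<card A. h k)"
  using assms
proof (induction A rule: finite_linorder_min_induct)
  case (insert b A)
  have b: "b \<notin> A" using insert by auto
  have "card A = card {a\<in>insert b A. a > b}"
    using insert.hyps by (intro arg_cong[where f = card]) auto
  moreover have "(\<Sum>a\<in>A. h (card {b\<in>A. b > a})) = (\<Sum>a\<in>A. h (card {b'\<in>insert b A. b' > a}))"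
    by (intro sum.cong refl arg_cong[where f = "\<lambda>X. h (card X)"]) (use insert.hyps in force)
  ultimately show ?case
    using insert.hyps(1) b insert.IH by (simp add: add.commute)
qed simp

text \<open>For the square \<open>n' = n\<close>, enlarging \<open>n\<close> adds a row and a
  column, each summing to \<open>n choose (c + 1)\<close>, and a corner \<open>n choose c\<close>,
  which is Pascal's rule. Every further column \<open>l >= n\<close> again adds
  \<open>n choose (c + 1)\<close>.\<close>

lemma sum_choose_min:
  assumes "n \<le> n'"
  shows "(\<Sum>k<n. \<Sum>l<n'. min k l choose c) = 2 * (n choose (c + 2)) + (n choose (c + 1)) * (1 + n' - n)"
  using assms
proof (induction n' rule: dec_induct)
  case base
  show ?case
  proof (induction n)
    case (Suc n)
    have s: "(\<Sum>k<n. k choose c) = n choose (c + 1)"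
      using sum_choose_upper[of c "n - 1"] by (cases n) (simp_all add: lessThan_Suc_atMost)
    have "(\<Sum>k<n. min n k choose c) = n choose (c + 1)" "(\<Sum>k<n. min k n choose c) = n choose (c + 1)"
      unfolding s[symmetric] by (auto intro!: sum.cong simp: min_def)
    thus ?case using Suc by (simp add: sum.distrib)
  qed simp
next
  case (step n')
  have "(\<Sum>k<n. k choose c) = n choose (c + 1)"
    using sum_choose_upper[of c "n - 1"] by (cases n) (simp_all add: lessThan_Suc_atMost)
  moreover have "(\<Sum>k<n. min k n' choose c) = (\<Sum>k<n. k choose c)"
    using step by (intro sum.cong) (auto simp: min_def)
  ultimately show ?case using step by (simp add: sum.distrib Suc_diff_le)
qed

lemma binomial_Suc_real:
  "real (n choose Suc c) = (real n - real c) / (real c + 1) * real (n choose c)"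
proof -
  have "Suc c * (n choose Suc c) = (n - c) * (n choose c)"
    using binomial_absorption[of c n] binomial_absorb_comp[of n c] by simp
  hence "real (Suc c) * real (n choose Suc c) = real (n - c) * real (n choose c)"
    by (metis of_nat_mult)
  also have "\<dots> = (real n - real c) * real (n choose c)"
    by (cases "c \<le> n") (auto simp: of_nat_diff)
  finally show ?thesis
    by (simp add: field_simps)
qed

text \<open>Factoring out the number of edges of the smaller clique makes the constant
  \<open>k = (c - 1) / (c + 1)\<close> of the overview appear.\<close>

lemma sum_choose_min_real:
  assumes "n \<le> n'" "c \<ge> 1"
  shows "real (\<Sum>k<n. \<Sum>l<n'. min k l choose (c - 1)) =
           real (n choose c) * (real n' - (real c - 1) / (real c + 1) * (real n + 1))"
proof -
  show ?thesis
    using sum_choose_min[OF assms(1), of "c - 1"] assms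
    by (simp add: of_nat_diff binomial_Suc_real field_simps)
qed

section \<open>Lower bound for the integral optimum\<close>

text \<open>Bound each minimum by the weight at the larger index; \<open>b\<close> is the larger
  index of only \<open>2 * b - 1\<close> ordered pairs.\<close>

lemma sum_min_pairs_le:
  fixes w :: "nat \<Rightarrow> nat"
  shows "(\<Sum>a\<in>{1..N}. \<Sum>b\<in>{1..N}. min (w a) (w b)) \<le> 2 * (\<Sum>b\<in>{1..N}. b * w b)"
proof (induction N)
  case (Suc N)
  have "(\<Sum>a\<in>{1..N}. min (w a) (w (Suc N))) \<le> (\<Sum>a\<in>{1..N}. w (Suc N))"
       "(\<Sum>a\<in>{1..N}. min (w (Suc N)) (w a)) \<le> (\<Sum>a\<in>{1..N}. w (Suc N))"
    by (intro sum_mono; simp)+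
  thus ?case using Suc by (simp add: sum.distrib)
qed simp

lemma sum_symmetric_ge:
  fixes F :: "nat \<Rightarrow> nat \<Rightarrow> nat"
  assumes "\<And>i j. F i j = F j i"
  shows "2 * (\<Sum>i<m. \<Sum>j<i. F i j) \<le> (\<Sum>i<m. \<Sum>j<m. F i j)"
proof (induction m)
  case (Suc m)
  have "(\<Sum>i<m. F i m) = (\<Sum>j<m. F m j)" by (simp add: assms)
  thus ?case using Suc by (simp add: sum.distrib)
qed simp

text \<open>\<open>B i\<close> plays the role of the set of positions of clique \<open>i\<close>.
  The right side is a weighted sum of positions, bounded below by minima over pairs of positions;
  these are regrouped into pairs of blocks, where only the sizes matter.\<close>

lemma sum_Min_partition_ge:
  fixes B :: "nat \<Rightarrow> nat set"
  assumes disj: "disjoint_family_on B {..<m}" and un: "(\<Union>i<m. B i) = {1..N}"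
  shows "(\<Sum>i<m. \<Sum>j<i. \<Sum>k<card (B i). \<Sum>l<card (B j). min k l choose c)
           \<le> (\<Sum>i<m. \<Sum>e\<in>k_subsets (B i) (Suc c). Min e)"
proof -
  define r where "r i a = card {b\<in>B i. b > a}" for i a
  \<comment> \<open>One weight function on all positions is needed to compare different blocks; by
    disjointness \<open>SOME\<close> can only pick the block containing \<open>b\<close>.\<close>
  define w where "w b = (r (SOME i. i < m \<and> b \<in> B i) b choose c)" for b
  have fin: "finite (B i)" if "i < m" for i
    by (rule finite_subset[of _ "{1..N}"]) (use un that in auto)
  have w: "w b = (r i b choose c)" if "i < m" "b \<in> B i" for i b
  proof -
    have "(SOME i. i < m \<and> b \<in> B i) = i"
      by (rule some_equality) (use disj that in \<open>auto simp: disjoint_family_on_def\<close>)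
    thus ?thesis by (simp add: w_def)
  qed
  have split: "sum f {1..N} = (\<Sum>i<m. \<Sum>b\<in>B i. f b)" for f :: "nat \<Rightarrow> nat"
    unfolding un[symmetric]
    by (rule sum.UNION_disjoint) (use fin disj in \<open>auto simp: disjoint_family_on_def\<close>)
  \<comment> \<open>The binomial is monotone in its upper argument, so minima of weights become
    minima of ranks.\<close>
  have mono: "min (k choose c) (l choose c) = (min k l choose c)" for k l
    by (cases "k \<le> l") (auto simp: min_def binomial_right_mono dest!: le_antisym)
  define F where "F i j = (\<Sum>k<card (B i). \<Sum>l<card (B j). min k l choose c)" for i j
  have "F i j = F j i" for i j
    unfolding F_def by (subst sum.swap) (simp add: min.commute)
  \<comment> \<open>The diagonal blocks are given up here; after scaling they amount to multiples of
    \<open>p i ^ (c + 1)\<close>, whose sum stays bounded.\<close>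
  hence "2 * (\<Sum>i<m. \<Sum>j<i. F i j) \<le> (\<Sum>i<m. \<Sum>j<m. F i j)"
    by (rule sum_symmetric_ge)
  also have "\<dots> = (\<Sum>i<m. \<Sum>a\<in>B i. \<Sum>j<m. \<Sum>b\<in>B j. min (w a) (w b))"
  proof (rule sum.cong[OF refl], goal_cases)
    case (1 i)
    have "(\<Sum>a\<in>B i. \<Sum>j<m. \<Sum>b\<in>B j. min (w a) (w b)) = (\<Sum>j<m. \<Sum>a\<in>B i. \<Sum>b\<in>B j. min (w a) (w b))"
      by (rule sum.swap)
    also have "\<dots> = (\<Sum>j<m. \<Sum>a\<in>B i. \<Sum>b\<in>B j. min (r i a) (r j b) choose c)"
      using 1 by (intro sum.cong refl) (simp add: w mono)
    \<comment> \<open>\<open>sum_rank\<close> is applied first to the inner block and then to the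
      outer one, replacing positions by ranks.\<close>
    also have "\<dots> = (\<Sum>j<m. \<Sum>a\<in>B i. \<Sum>l<card (B j). min (r i a) l choose c)"
      unfolding r_def by (intro sum.cong refl sum_rank[where h = "\<lambda>l. min _ l choose c"] fin) auto
    also have "\<dots> = (\<Sum>j<m. F i j)"
      unfolding F_def r_def using 1
      by (intro sum.cong refl sum_rank[where h = "\<lambda>k. \<Sum>l<card (B _). min k l choose c"] fin) auto
    finally show ?case by simp
  qed
  also have "\<dots> = (\<Sum>a\<in>{1..N}. \<Sum>b\<in>{1..N}. min (w a) (w b))"
    by (simp only: split)
  also have "\<dots> \<le> 2 * (\<Sum>b\<in>{1..N}. b * w b)"
    by (rule sum_min_pairs_le)
  also have "(\<Sum>b\<in>{1..N}. b * w b) = (\<Sum>i<m. \<Sum>b\<in>B i. b * (r i b choose c))"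
    unfolding split by (intro sum.cong refl) (simp add: w)
  also have "\<dots> = (\<Sum>i<m. \<Sum>e\<in>k_subsets (B i) (Suc c). Min e)"
    unfolding r_def by (intro sum.cong refl sum_Min_k_subsets[symmetric] fin) auto
  finally show ?thesis by (simp add: F_def)
qed

lemma sum_k_subsets_image:
  assumes "inj_on f A"
  shows "(\<Sum>e\<in>k_subsets A k. g (f ` e)) = (\<Sum>e\<in>k_subsets (f ` A) k. g e)"
proof (rule sum.reindex_bij_betw)
  show "bij_betw (\<lambda>e. f ` e) (k_subsets A k) (k_subsets (f ` A) k)"
    unfolding bij_betw_def
  proof
    show "inj_on ((`) f) (k_subsets A k)"
      by (rule inj_on_subset[OF inj_on_image_Pow[OF assms]]) (auto simp: k_subsets_def)
    show "(`) f ` k_subsets A k = k_subsets (f ` A) k"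
    proof (intro equalityI subsetI)
      fix e assume e: "e \<in> k_subsets (f ` A) k"
      then obtain d where "d \<subseteq> A" "e = f ` d" by (auto simp: k_subsets_def subset_image_iff)
      thus "e \<in> (`) f ` k_subsets A k"
        using e assms by (auto simp: k_subsets_def card_image inj_on_subset)
    qed (use assms in \<open>auto simp: k_subsets_def card_image inj_on_subset\<close>)
  qed
qed


text \<open>As \<open>c >= 1\<close>, edges are nonempty, so no edge lies in two disjoint
  cliques.\<close>

lemma sum_cliques:
  fixes m :: nat
  assumes "disjoint_family_on Q {..<m}" "\<And>i. i < m \<Longrightarrow> finite (Q i)" "c \<ge> 1"
  shows "(\<Sum>e\<in>(\<Union>i<m. k_subsets (Q i) c). f e) = (\<Sum>i<m. \<Sum>e\<in>k_subsets (Q i) c. f e)"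
proof (rule sum.UNION_disjoint)
  show "\<forall>i\<in>{..<m}. \<forall>j\<in>{..<m}. i \<noteq> j \<longrightarrow> k_subsets (Q i) c \<inter> k_subsets (Q j) c = {}"
  proof (intro ballI impI equals0I)
    fix i j e assume ij: "i \<in> {..<m}" "j \<in> {..<m}" "i \<noteq> j" "e \<in> k_subsets (Q i) c \<inter> k_subsets (Q j) c"
    hence "e \<subseteq> Q i \<inter> Q j" by (auto simp: k_subsets_def)
    also have "Q i \<inter> Q j = {}" using ij assms(1) by (auto simp: disjoint_family_on_def)
    finally show False using ij assms(3) by (auto simp: k_subsets_def)
  qed
qed (use assms in \<open>auto simp: finite_k_subsets\<close>)

lemma le_mssc_opt:
  assumes "finite V" and "\<And>\<sigma>. bij_betw \<sigma> V {1..card V} \<Longrightarrow> y \<le> mssc_cost E \<sigma>"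
  shows "y \<le> mssc_opt V E"
  unfolding mssc_opt_def
proof (rule cInf_greatest)
  obtain \<sigma> where "bij_betw \<sigma> V {1..card V}"
    using finite_same_card_bij[OF assms(1), of "{1..card V}"] by auto
  thus "{mssc_cost E \<sigma> |\<sigma>. bij_betw \<sigma> V {1..card V}} \<noteq> {}" by blast
qed (use assms(2) in blast)

text \<open>An ordering carries the cliques to a partition of the positions. Decreasing sizes make
  clique \<open>i\<close> the smaller one in each pair with \<open>j < i\<close>, as
  \<open>sum_choose_min_real\<close> requires.\<close>

lemma mssc_opt_cliques_ge:
  assumes disj: "disjoint_family_on Q {..<m}" and fin: "\<And>i. i < m \<Longrightarrow> finite (Q i)" and c: "c \<ge> 1"
    and anti: "\<And>i j. j < i \<Longrightarrow> i < m \<Longrightarrow> card (Q i) \<le> card (Q j)"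
  shows "(\<Sum>i<m. real (card (Q i) choose c) *
            ((\<Sum>j<i. real (card (Q j))) - (real c - 1) / (real c + 1) * (real i * (real (card (Q i)) + 1))))
           \<le> mssc_opt (\<Union>i<m. Q i) (\<Union>i<m. k_subsets (Q i) c)"
  (is "?L \<le> mssc_opt ?V ?E")
proof (rule le_mssc_opt)
  show "finite ?V" using fin by auto
next
  fix \<sigma> assume \<sigma>: "bij_betw \<sigma> ?V {1..card ?V}"
  define B where "B i = \<sigma> ` Q i" for i
  have inj: "inj_on \<sigma> (Q i)" if "i < m" for i
    using bij_betw_imp_inj_on[OF \<sigma>] by (rule inj_on_subset) (use that in auto)
  have card_B: "card (B i) = card (Q i)" if "i < m" for i
    using inj[OF that] by (simp add: B_def card_image)
  have disj_B: "disjoint_family_on B {..<m}"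
    unfolding disjoint_family_on_def
  proof (intro ballI impI)
    fix i j assume ij: "i \<in> {..<m}" "j \<in> {..<m}" "i \<noteq> j"
    have "B i \<inter> B j = \<sigma> ` (Q i \<inter> Q j)"
      unfolding B_def using bij_betw_imp_inj_on[OF \<sigma>]
      by (rule inj_on_image_Int[symmetric]) (use ij in auto)
    also have "Q i \<inter> Q j = {}" using ij disj by (auto simp: disjoint_family_on_def)
    finally show "B i \<inter> B j = {}" by simp
  qed
  have un_B: "(\<Union>i<m. B i) = {1..card ?V}"
    using bij_betw_imp_surj_on[OF \<sigma>] by (simp add: B_def image_UN)
  have "?L = (\<Sum>i<m. \<Sum>j<i. real (\<Sum>k<card (B i). \<Sum>l<card (B j). min k l choose (c - 1)))"
  proof (rule sum.cong[OF refl])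
    fix i assume i: "i \<in> {..<m}"
    have "(\<Sum>j<i. real (\<Sum>k<card (B i). \<Sum>l<card (B j). min k l choose (c - 1)))
      = (\<Sum>j<i. real (card (Q i) choose c) * (real (card (Q j)) - (real c - 1) / (real c + 1) * (real (card (Q i)) + 1)))"
      by (intro sum.cong refl) (subst sum_choose_min_real, use i card_B anti c in auto)
    also have "\<dots> = real (card (Q i) choose c) *
            ((\<Sum>j<i. real (card (Q j))) - (real c - 1) / (real c + 1) * (real i * (real (card (Q i)) + 1)))"
      unfolding sum_distrib_left[symmetric] sum_subtractf by simp
    finally show "real (card (Q i) choose c) *
            ((\<Sum>j<i. real (card (Q j))) - (real c - 1) / (real c + 1) * (real i * (real (card (Q i)) + 1)))
        = (\<Sum>j<i. real (\<Sum>k<card (B i). \<Sum>l<card (B j). min k l choose (c - 1)))" ..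
  qed
  also have "\<dots> = real (\<Sum>i<m. \<Sum>j<i. \<Sum>k<card (B i). \<Sum>l<card (B j). min k l choose (c - 1))"
    by simp
  also have "\<dots> \<le> real (\<Sum>i<m. \<Sum>e\<in>k_subsets (B i) (Suc (c - 1)). Min e)"
    by (rule of_nat_mono, rule sum_Min_partition_ge[OF disj_B un_B])
  also have "\<dots> = (\<Sum>i<m. \<Sum>e\<in>k_subsets (Q i) c. real (Min (\<sigma> ` e)))"
    unfolding of_nat_sum
  proof (rule sum.cong[OF refl])
    fix i assume "i \<in> {..<m}"
    thus "(\<Sum>e\<in>k_subsets (B i) (Suc (c - 1)). real (Min e)) = (\<Sum>e\<in>k_subsets (Q i) c. real (Min (\<sigma> ` e)))"
      using sum_k_subsets_image[OF inj, of i "\<lambda>e. real (Min e)" c] c by (simp add: B_def)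
  qed
  also have "\<dots> = mssc_cost ?E \<sigma>"
    unfolding mssc_cost_def by (rule sum_cliques[OF disj fin c, symmetric])
  finally show "?L \<le> mssc_cost ?E \<sigma>" .
qed

section \<open>A fractional solution for a union of cliques\<close>

lemma sum_real_window: "(\<Sum>t\<in>{a<..a + l}. real t) = real l * (real a + (real l + 1) / 2)"
proof (induction l)
  case (Suc l)
  have "{a<..a + Suc l} = insert (a + Suc l) {a<..a + l}" by auto
  thus ?case using Suc by (simp add: field_simps)
qed simp

lemma lp_obj_nonneg:
  assumes "lp_feasible V E x u"
  shows "lp_obj V E u \<ge> 0"
  unfolding lp_obj_def using assms by (intro sum_nonneg mult_nonneg_nonneg) (auto simp: lp_feasible_def)

lemma lp_opt_le:
  assumes "lp_feasible V E x u"
  shows "lp_opt V E \<le> lp_obj V E u"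
  unfolding lp_opt_def
  by (rule cInf_lower) (use assms lp_obj_nonneg in \<open>auto intro!: bdd_belowI[of _ 0]\<close>)

lemma lp_opt_nonneg:
  assumes "lp_feasible V E x u"
  shows "lp_opt V E \<ge> 0"
  unfolding lp_opt_def
  by (rule cInf_greatest) (use assms lp_obj_nonneg in auto)

text \<open>The cliques are processed one after the other, clique \<open>i\<close> being covered uniformly during
  the \<open>l i\<close> time steps of its window; the steps after the last window carry an irrelevant
  uniform filling.\<close>

lemma lp_feasible_cliques:
  fixes l :: "nat \<Rightarrow> nat"
  assumes disj: "disjoint_family_on Q {..<m}" and fin: "\<And>i. i < m \<Longrightarrow> finite (Q i)" and c: "c \<ge> 1"
    and card_Q: "\<And>i. i < m \<Longrightarrow> card (Q i) = c * l i" and l: "\<And>i. i < m \<Longrightarrow> l i > 0"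
  defines "V \<equiv> (\<Union>i<m. Q i)" and "E \<equiv> (\<Union>i<m. k_subsets (Q i) c)"
  shows "\<exists>x u. lp_feasible V E x u \<and>
           lp_obj V E u = (\<Sum>i<m. real (card (Q i) choose c) * ((\<Sum>j<i. real (l j)) + (real (l i) + 1) / 2))"
proof -
  \<comment> \<open>The windows \<open>{T i<..T i + l i}\<close> tile \<open>{1..T m}\<close>;
    below, \<open>s t\<close> turns out to be the index of the window containing
    \<open>t\<close>.\<close>
  define T where "T i = (\<Sum>j<i. l j)" for i
  define s where "s t = (LEAST i. t \<le> T (Suc i))" for t
  \<comment> \<open>An edge of the current clique \<open>i\<close> collects \<open>c\<close> shares
    of \<open>1 / (c * l i)\<close>, exactly the rate \<open>1 / l i\<close> that covers it within
    \<open>l i\<close> steps.\<close>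
  define x where "x v t = (if t \<le> T m then if v \<in> Q (s t) then 1 / real (card (Q (s t))) else 0
                           else 1 / real (card V))" for v t
  define u where "u e t = (if t \<le> T m \<and> e \<subseteq> Q (s t) then 1 / real (l (s t)) else 0)" for e t
  have T_mono: "T i \<le> T j" if "i \<le> j" for i j
    unfolding T_def using that by (intro sum_mono2) auto
  have fin_V: "finite V" using fin by (auto simp: V_def)
  have card_V: "card V = c * T m"
    unfolding V_def T_def using fin disj card_Q
    by (subst card_UN_disjoint) (auto simp: disjoint_family_on_def sum_distrib_left)
  hence T_le: "T m \<le> card V" using c by simp
  have s_less: "s t < m" if "t \<in> {1..T m}" for t
  proof -
    have "m \<noteq> 0" using that by (intro notI) (simp add: T_def)
    hence "s t \<le> m - 1" unfolding s_def using that by (intro Least_le) auto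
    thus ?thesis using \<open>m \<noteq> 0\<close> by simp
  qed
  have s_eq: "s t = i" if "t \<in> {T i<..T i + l i}" for t i
    unfolding s_def
  proof (rule Least_equality)
    fix j assume "t \<le> T (Suc j)"
    thus "i \<le> j" using T_mono[of "Suc j" i] that by (cases "i \<le> j") auto
  qed (use that in \<open>simp add: T_def\<close>)
  have s_window: "t \<in> {T (s t)<..T (s t) + l (s t)}" if t: "t \<in> {1..T m}" for t
  proof -
    have "t \<le> T (Suc (s t))"
      unfolding s_def by (rule LeastI[of _ m]) (use t T_mono[of m "Suc m"] in auto)
    moreover have "T (s t) < t"
    proof (cases "s t")
      case 0
      thus ?thesis using t by (simp add: T_def)
    next
      case (Suc k)
      thus ?thesis using not_less_Least[of k "\<lambda>i. t \<le> T (Suc i)"] by (simp add: s_def)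
    qed
    ultimately show ?thesis by (simp add: T_def)
  qed
  have window_subset: "{T i<..T i + l i} \<subseteq> {1..card V}" if "i < m" for i
    using T_mono[of "Suc i" m] that T_le by (auto simp: T_def)
  have clique_unique: "e \<subseteq> Q j \<longleftrightarrow> j = i" if "e \<in> k_subsets (Q i) c" "i < m" "j < m" for e i j
  proof
    assume "e \<subseteq> Q j"
    hence "e \<subseteq> Q i \<inter> Q j" using that by (auto simp: k_subsets_def)
    moreover have "e \<noteq> {}" using that c by (auto simp: k_subsets_def)
    ultimately show "j = i" using that disj by (fastforce simp: disjoint_family_on_def)
  qed (use that in \<open>auto simp: k_subsets_def\<close>)
  have u_eq: "u e t = (if t \<in> {T i<..T i + l i} then 1 / real (l i) else 0)"
    if "e \<in> k_subsets (Q i) c" "i < m" "t \<in> {1..card V}" for e i t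
  proof (cases "t \<le> T m")
    case True
    hence "t \<in> {1..T m}" using that by auto
    hence "e \<subseteq> Q (s t) \<longleftrightarrow> t \<in> {T i<..T i + l i}"
      using clique_unique[OF that(1,2) s_less] s_eq[of t i] s_window[of t] by metis
    thus ?thesis using True s_eq[of t i] by (auto simp: u_def)
  next
    case False
    thus ?thesis using T_mono[of "Suc i" m] that by (auto simp: u_def T_def)
  qed
  \<comment> \<open>The constant \<open>f = 1\<close> yields the covering equation, and
    \<open>f = real\<close> the contribution to the objective.\<close>
  have u_sum: "(\<Sum>t\<in>{1..card V}. f t * u e t) = (\<Sum>t\<in>{T i<..T i + l i}. f t) / real (l i)"
    if "e \<in> k_subsets (Q i) c" "i < m" for e i and f :: "nat \<Rightarrow> real"
  proof -
    have "(\<Sum>t\<in>{1..card V}. f t * u e t) = (\<Sum>t\<in>{1..card V}. if t \<in> {T i<..T i + l i} then f t / real (l i) else 0)"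
      by (intro sum.cong refl) (simp add: u_eq[OF that])
    also have "\<dots> = (\<Sum>t\<in>{T i<..T i + l i}. f t / real (l i))"
      using window_subset[OF that(2)] by (subst sum.inter_restrict[symmetric]) (auto simp: Int_absorb1)
    finally show ?thesis by (simp add: sum_divide_distrib)
  qed
  have "lp_feasible V E x u"
    unfolding lp_feasible_def
  proof (intro conjI ballI)
    fix e t assume e: "e \<in> E" and t: "t \<in> {1..card V}"
    have fin_e: "finite e" and card_e: "card e = c"
      using e fin by (auto simp: E_def k_subsets_def intro: finite_subset)
    show "(\<Sum>v\<in>e. x v t) - u e t \<ge> 0"
    proof (cases "t \<le> T m \<and> e \<subseteq> Q (s t)")
      case True
      hence "(\<Sum>v\<in>e. x v t) = (\<Sum>v\<in>e. 1 / real (card (Q (s t))))"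
        by (intro sum.cong refl) (auto simp: x_def)
      also have "\<dots> = u e t"
        using True s_less[of t] t card_e card_Q[of "s t"] l[of "s t"] c by (simp add: u_def)
      finally show ?thesis by simp
    next
      case False
      thus ?thesis by (auto simp: u_def x_def intro!: sum_nonneg)
    qed
  next
    fix e assume "e \<in> E"
    then obtain i where i: "i < m" "e \<in> k_subsets (Q i) c" by (auto simp: E_def)
    thus "(\<Sum>t\<in>{1..card V}. u e t) = 1"
      using u_sum[OF i(2,1), of "\<lambda>_. 1"] l[of i] by simp
  next
    fix t assume t: "t \<in> {1..card V}"
    show "(\<Sum>v\<in>V. x v t) = 1"
    proof (cases "t \<le> T m")
      case True
      hence s: "s t < m" using s_less[of t] t by simp
      have "(\<Sum>v\<in>V. x v t) = (\<Sum>v\<in>V. if v \<in> Q (s t) then 1 / real (card (Q (s t))) else 0)"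
        using True by (simp add: x_def)
      also have "\<dots> = (\<Sum>v\<in>Q (s t). 1 / real (card (Q (s t))))"
        using fin_V s by (intro sum.mono_neutral_cong_right) (auto simp: V_def)
      also have "\<dots> = 1" using s card_Q[of "s t"] l[of "s t"] c by simp
      finally show ?thesis .
    next
      case False
      thus ?thesis using t by (simp add: x_def)
    qed
  qed (auto simp: x_def u_def)
  moreover have "lp_obj V E u =
      (\<Sum>i<m. real (card (Q i) choose c) * ((\<Sum>j<i. real (l j)) + (real (l i) + 1) / 2))"
  proof -
    have "lp_obj V E u = (\<Sum>e\<in>E. \<Sum>t\<in>{1..card V}. real t * u e t)"
      unfolding lp_obj_def by (rule sum.swap)
    also have "\<dots> = (\<Sum>i<m. \<Sum>e\<in>k_subsets (Q i) c. \<Sum>t\<in>{1..card V}. real t * u e t)"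
      unfolding E_def by (rule sum_cliques[OF disj fin c])
    also have "\<dots> = (\<Sum>i<m. \<Sum>e\<in>k_subsets (Q i) c. real (T i) + (real (l i) + 1) / 2)"
    proof (intro sum.cong refl)
      fix i e assume "i \<in> {..<m}" "e \<in> k_subsets (Q i) c"
      thus "(\<Sum>t\<in>{1..card V}. real t * u e t) = real (T i) + (real (l i) + 1) / 2"
        using u_sum[of e i real] l[of i] by (simp add: sum_real_window)
    qed
    also have "\<dots> = (\<Sum>i<m. real (card (Q i) choose c) * (real (T i) + (real (l i) + 1) / 2))"
      by (intro sum.cong refl) (simp add: n_subsets[OF fin, folded k_subsets_def])
    finally show ?thesis by (simp add: T_def)
  qed
  ultimately show ?thesis by blast
qed


section \<open>Limits under scaling and estimates of power sums\<close>

lemma tendsto_floor_div: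
  fixes p :: real
  assumes "p \<ge> 0"
  shows "(\<lambda>n. real (nat \<lfloor>real n * p\<rfloor>) / real n) \<longlonglongrightarrow> p"
proof (rule real_tendsto_sandwich)
  show "(\<lambda>n. p - 1 / real n) \<longlonglongrightarrow> p"
    using tendsto_diff[OF tendsto_const lim_1_over_n, of p] by simp
  show "\<forall>\<^sub>F n in sequentially. p - 1 / real n \<le> real (nat \<lfloor>real n * p\<rfloor>) / real n"
    using eventually_gt_at_top[of 0]
  proof eventually_elim
    case (elim n)
    have "real n * p - 1 \<le> real (nat \<lfloor>real n * p\<rfloor>)" by linarith
    hence "(real n * p - 1) / real n \<le> real (nat \<lfloor>real n * p\<rfloor>) / real n"
      by (rule divide_right_mono) simp
    thus ?case using elim by (simp add: diff_divide_distrib)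
  qed
  show "\<forall>\<^sub>F n in sequentially. real (nat \<lfloor>real n * p\<rfloor>) / real n \<le> p"
    using eventually_gt_at_top[of 0]
  proof eventually_elim
    case (elim n)
    have "real (nat \<lfloor>real n * p\<rfloor>) \<le> real n * p" using assms by simp
    thus ?case using elim by (simp add: field_simps)
  qed
qed auto

text \<open>Induction through \<open>binomial_Suc_real\<close>: each new factor is
  \<open>X n - c\<close> up to a constant, and the shift by \<open>c\<close> vanishes after division
  by \<open>n\<close>.\<close>

lemma tendsto_binomial_div_power:
  fixes X :: "nat \<Rightarrow> nat"
  assumes "(\<lambda>n. real (X n) / real n) \<longlonglongrightarrow> x"
  shows "(\<lambda>n. real (X n choose c) / real n ^ c) \<longlonglongrightarrow> x ^ c / fact c"
proof (induction c)
  case (Suc c)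
  have "(\<lambda>n. (real (X n) / real n - real c * (1 / real n)) / (real c + 1) * (real (X n choose c) / real n ^ c))
          \<longlonglongrightarrow> (x - real c * 0) / (real c + 1) * (x ^ c / fact c)"
    by (intro tendsto_intros assms Suc lim_1_over_n) auto
  moreover have "(x - real c * 0) / (real c + 1) * (x ^ c / fact c) = x ^ Suc c / fact (Suc c)"
    by (simp add: field_simps)
  moreover have "(real (X n) / real n - real c * (1 / real n)) / (real c + 1) * (real (X n choose c) / real n ^ c)
      = real (X n choose Suc c) / real n ^ Suc c" for n
    unfolding binomial_Suc_real by (cases "n = 0") (simp_all add: field_simps)
  ultimately show ?case by (simp only:)
qed simp

text \<open>Comparison with the integral of the decreasing function \<open>x powr (k - 1)\<close>
  from 1 to \<open>Suc i\<close>, done by telescoping with the mean value theorem.\<close>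

lemma sum_powr_ge:
  fixes k :: real
  assumes "0 < k" "k < 1"
  shows "(real (Suc i) powr k - 1) / k \<le> (\<Sum>j<i. real (Suc j) powr (k - 1))"
proof (induction i)
  case (Suc i)
  have "\<exists>z. z > real (Suc i) \<and> z < real (Suc (Suc i)) \<and>
      real (Suc (Suc i)) powr k - real (Suc i) powr k = (real (Suc (Suc i)) - real (Suc i)) * (k * z powr (k - 1))"
    by (rule MVT2) (auto intro!: derivative_eq_intros)
  then obtain z where z: "z > real (Suc i)"
    "real (Suc (Suc i)) powr k - real (Suc i) powr k = k * z powr (k - 1)" by auto
  have "z powr (k - 1) \<le> real (Suc i) powr (k - 1)"
    using z(1) assms by (intro powr_mono2') auto
  hence "real (Suc (Suc i)) powr k - real (Suc i) powr k \<le> k * real (Suc i) powr (k - 1)"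
    using z(2) assms by simp
  thus ?case using Suc assms by (simp add: field_simps)
qed simp

lemma harmonic_unbounded: "\<exists>m. (\<Sum>i<m. 1 / real (Suc i)) > C"
proof (rule ccontr)
  assume "\<not> ?thesis"
  hence "summable (\<lambda>i. 1 / real (Suc i))"
    by (intro summableI_nonneg_bounded[where x = C]) (auto simp: not_less)
  thus False
    using not_summable_harmonic[where 'a = real] summable_Suc_iff[of "\<lambda>i. 1 / real i"]
    by (simp add: inverse_eq_divide)
qed

lemma sum_Suc_powr_bounded:
  fixes s :: real
  assumes "s < -1"
  obtains C where "\<And>m. (\<Sum>i<m. real (Suc i) powr s) \<le> C"
proof
  have "summable (\<lambda>i. real (Suc i) powr s)"
    using summable_Suc_iff[of "\<lambda>i. real i powr s"] assms by (simp only: summable_real_powr_iff)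
  thus "(\<Sum>i<m. real (Suc i) powr s) \<le> (\<Sum>i. real (Suc i) powr s)" for m
    by (intro sum_le_suminf) auto
qed

section \<open>The power law and its integer approximation\<close>

text \<open>This is the limit form of integral cost minus \<open>\<rho>\<close> times fractional
  cost. It is at least \<open>\<epsilon> / k\<close> times the harmonic sum minus a constant, so it
  becomes positive.\<close>

lemma power_law_gap:
  fixes c :: nat and \<epsilon> :: real
  assumes c: "c \<ge> 2" and \<epsilon>: "\<epsilon> > 0"
  defines "k \<equiv> (real c - 1) / (real c + 1)" and "\<rho> \<equiv> (2 * real c / (real c + 1))\<^sup>2 - \<epsilon>"
  defines "p \<equiv> \<lambda>i. real (Suc i) powr (k - 1)"
  shows "\<exists>m. (\<Sum>i<m. p i ^ c * (real c * ((\<Sum>j<i. p j) - k * (real i * p i)) -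
                 \<rho> * ((\<Sum>j<i. p j) + p i / 2))) > 0"
proof -
  have k: "0 < k" "k < 1" using c by (auto simp: k_def field_simps)
  \<comment> \<open>This is the identity \<open>c * (1 - k^2) = (2 * c / (c + 1))^2\<close>.\<close>
  have \<rho>: "real c - \<rho> = real c * k\<^sup>2 + \<epsilon>"
    unfolding \<rho>_def k_def power_divide
    by (simp add: divide_simps) (simp add: algebra_simps power2_eq_square)
  \<comment> \<open>This exponent is what turns \<open>p i ^ c * Suc i powr k\<close> into the
    harmonic term \<open>1 / Suc i\<close>.\<close>
  have exponent: "(k - 1) * real c = - 1 - k"
    unfolding k_def by (simp add: field_simps)
  have p_power: "p i ^ c = real (Suc i) powr (- 1 - k)" for i
    by (simp add: p_def powr_realpow[symmetric] powr_powr exponent del: of_nat_Suc)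
  have p_power_Suc: "p i ^ c * p i = real (Suc i) powr (- 2)" for i
    unfolding p_power unfolding p_def by (simp add: powr_add[symmetric] del: of_nat_Suc)
  obtain C1 where C1: "\<And>m. (\<Sum>i<m. real (Suc i) powr (- 1 - k)) \<le> C1"
    using sum_Suc_powr_bounded[of "- 1 - k"] k by auto
  obtain C2 where C2: "\<And>m. (\<Sum>i<m. real (Suc i) powr (- 2)) \<le> C2"
    using sum_Suc_powr_bounded[of "- 2"] by auto
  define H where "H m = (\<Sum>i<m. 1 / real (Suc i))" for m
  define A where "A m = (\<Sum>i<m. p i ^ c * (\<Sum>j<i. p j))" for m
  have A_ge: "A m \<ge> (H m - C1) / k" for m
  proof -
    have "(H m - C1) / k \<le> (H m - (\<Sum>i<m. real (Suc i) powr (- 1 - k))) / k"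
      using C1[of m] k by (intro divide_right_mono) auto
    also have "\<dots> = (\<Sum>i<m. p i ^ c * ((real (Suc i) powr k - 1) / k))"
      unfolding H_def sum_subtractf[symmetric] sum_divide_distrib
    proof (rule sum.cong[OF refl])
      fix i
      have "p i ^ c * real (Suc i) powr k = 1 / real (Suc i)"
        unfolding p_power powr_add[symmetric] by (simp add: powr_minus_divide del: of_nat_Suc)
      thus "(1 / real (Suc i) - real (Suc i) powr (- 1 - k)) / k = p i ^ c * ((real (Suc i) powr k - 1) / k)"
        by (simp add: p_power algebra_simps diff_divide_distrib del: of_nat_Suc)
    qed
    also have "\<dots> \<le> A m"
      unfolding A_def
      by (intro sum_mono mult_left_mono) (auto simp: p_def intro!: sum_powr_ge[OF k, unfolded of_nat_Suc])
    finally show ?thesis .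
  qed
  have second: "(\<Sum>i<m. real i * (p i ^ c * p i)) \<le> H m" for m
    unfolding H_def p_power_Suc
  proof (rule sum_mono)
    fix i
    have "real i * real (Suc i) powr (- 2) \<le> real (Suc i) * real (Suc i) powr (- 2)"
      by (intro mult_right_mono) auto
    also have "\<dots> = 1 / real (Suc i)"
      by (simp add: powr_minus_divide power2_eq_square del: of_nat_Suc)
    finally show "real i * real (Suc i) powr (- 2) \<le> 1 / real (Suc i)" .
  qed
  \<comment> \<open>The threshold makes \<open>\<epsilon> / k * H m\<close> exceed all the bounded
    terms together.\<close>
  obtain m where m: "H m > ((real c * k\<^sup>2 + \<epsilon>) * C1 / k + \<bar>\<rho>\<bar> / 2 * C2) / (\<epsilon> / k)"
    unfolding H_def using harmonic_unbounded by blast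
  have "0 < \<epsilon> / k * H m - (real c * k\<^sup>2 + \<epsilon>) * C1 / k - \<bar>\<rho>\<bar> / 2 * C2"
    using m[unfolded pos_divide_less_eq[OF divide_pos_pos[OF \<epsilon> k(1)]]]
    by (simp only: mult.commute[of "H m"])
  \<comment> \<open>The two multiples \<open>c * k * H m\<close> cancel, leaving only the surplus
    from \<open>\<epsilon>\<close>.\<close>
  also have "\<dots> = (real c * k\<^sup>2 + \<epsilon>) * ((H m - C1) / k) - real c * k * H m - \<bar>\<rho>\<bar> / 2 * C2"
    using k by (simp add: field_simps power2_eq_square)
  also have "\<dots> \<le> (real c - \<rho>) * A m - real c * k * (\<Sum>i<m. real i * (p i ^ c * p i))
                     - \<rho> / 2 * (\<Sum>i<m. p i ^ c * p i)"
  proof (intro diff_mono)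
    show "(real c * k\<^sup>2 + \<epsilon>) * ((H m - C1) / k) \<le> (real c - \<rho>) * A m"
      unfolding \<rho> using A_ge[of m] \<epsilon> by (intro mult_left_mono) auto
    show "real c * k * (\<Sum>i<m. real i * (p i ^ c * p i)) \<le> real c * k * H m"
      using second[of m] k by (intro mult_left_mono) auto
    \<comment> \<open>The absolute value is taken because a large \<open>\<epsilon>\<close> makes
      \<open>\<rho>\<close> negative.\<close>
    have "\<rho> / 2 * (\<Sum>i<m. p i ^ c * p i) \<le> \<bar>\<rho>\<bar> / 2 * (\<Sum>i<m. p i ^ c * p i)"
      by (intro mult_right_mono sum_nonneg) (auto simp: p_def)
    also have "\<dots> \<le> \<bar>\<rho>\<bar> / 2 * C2"
      unfolding p_power_Suc using C2[of m] by (intro mult_left_mono) auto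
    finally show "\<rho> / 2 * (\<Sum>i<m. p i ^ c * p i) \<le> \<bar>\<rho>\<bar> / 2 * C2" .
  qed
  also have "\<dots> = (\<Sum>i<m. p i ^ c * (real c * ((\<Sum>j<i. p j) - k * (real i * p i)) -
                 \<rho> * ((\<Sum>j<i. p j) + p i / 2)))"
    unfolding A_def sum_distrib_left[where A = "{..<m}"] sum_subtractf[symmetric]
    by (intro sum.cong refl) (simp add: algebra_simps)
  finally show ?thesis by blast
qed

text \<open>With \<open>m\<close> fixed, take \<open>l i\<close> as the floor of
  \<open>n * p i\<close>. Both sides divided by \<open>n ^ (c + 1)\<close> converge as
  \<open>n\<close> grows, and the strict inequality of \<open>power_law_gap\<close> between the
  limits passes to large \<open>n\<close>.\<close>

lemma integer_power_law_gap:
  fixes c :: nat and \<epsilon> :: real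
  assumes c: "c \<ge> 2" and \<epsilon>: "\<epsilon> > 0"
  obtains m :: nat and l :: "nat \<Rightarrow> nat" where
    "m > 0" "\<And>i. i < m \<Longrightarrow> l i > 0" "\<And>i j. j \<le> i \<Longrightarrow> l i \<le> l j"
    "((2 * real c / (real c + 1))\<^sup>2 - \<epsilon>) *
       (\<Sum>i<m. real ((c * l i) choose c) * ((\<Sum>j<i. real (l j)) + (real (l i) + 1) / 2))
     \<le> (\<Sum>i<m. real ((c * l i) choose c) *
          ((\<Sum>j<i. real (c * l j)) - (real c - 1) / (real c + 1) * (real i * (real (c * l i) + 1))))"
proof -
  define k where "k = (real c - 1) / (real c + 1)"
  define \<rho> where "\<rho> = (2 * real c / (real c + 1))\<^sup>2 - \<epsilon>"
  define p where "p i = real (Suc i) powr (k - 1)" for i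
  have k: "k < 1" by (simp add: k_def field_simps)
  obtain m where m: "(\<Sum>i<m. p i ^ c * (real c * ((\<Sum>j<i. p j) - k * (real i * p i)) -
                 \<rho> * ((\<Sum>j<i. p j) + p i / 2))) > 0"
    using power_law_gap[OF c \<epsilon>] unfolding k_def \<rho>_def p_def by blast
  define l where "l n i = nat \<lfloor>real n * p i\<rfloor>" for n i
  have p_pos: "p i > 0" for i by (simp add: p_def)
  have p_anti: "p i \<le> p j" if "j \<le> i" for i j
    unfolding p_def using that k by (intro powr_mono2') auto
  have l_anti: "l n i \<le> l n j" if "j \<le> i" for n i j
    unfolding l_def using p_anti[OF that] by (intro nat_mono floor_mono mult_left_mono) auto
  have l_lim: "(\<lambda>n. real (l n i) / real n) \<longlonglongrightarrow> p i" for i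
    unfolding l_def using p_pos[of i] by (intro tendsto_floor_div) simp
  have W_lim: "(\<lambda>n. real ((c * l n i) choose c) / real n ^ c) \<longlonglongrightarrow> (real c * p i) ^ c / fact c" for i
    using tendsto_mult[OF tendsto_const l_lim, of "real c" i] by (intro tendsto_binomial_div_power) simp
  \<comment> \<open>\<open>D n\<close> is the right side minus the left side of the claim for the
    scale \<open>n\<close>.\<close>
  define D where "D n = (\<Sum>i<m. real ((c * l n i) choose c) *
     (real c * (\<Sum>j<i. real (l n j)) - k * (real i * (real c * real (l n i) + 1))
       - \<rho> * ((\<Sum>j<i. real (l n j)) + (real (l n i) + 1) / 2)))" for n
  have "(\<lambda>n. \<Sum>i<m. real ((c * l n i) choose c) / real n ^ c *
     (real c * (\<Sum>j<i. real (l n j) / real n) - k * (real i * (real c * (real (l n i) / real n) + 1 / real n))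
       - \<rho> * ((\<Sum>j<i. real (l n j) / real n) + (real (l n i) / real n + 1 / real n) / 2)))
     \<longlonglongrightarrow> (\<Sum>i<m. (real c * p i) ^ c / fact c *
     (real c * (\<Sum>j<i. p j) - k * (real i * (real c * p i + 0))
       - \<rho> * ((\<Sum>j<i. p j) + (p i + 0) / 2)))"
    by (intro tendsto_intros l_lim W_lim lim_1_over_n) auto
  moreover have "(\<Sum>i<m. (real c * p i) ^ c / fact c *
     (real c * (\<Sum>j<i. p j) - k * (real i * (real c * p i + 0))
       - \<rho> * ((\<Sum>j<i. p j) + (p i + 0) / 2)))
     = real c ^ c / fact c * (\<Sum>i<m. p i ^ c * (real c * ((\<Sum>j<i. p j) - k * (real i * p i)) -
                 \<rho> * ((\<Sum>j<i. p j) + p i / 2)))"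
    unfolding sum_distrib_left[where A = "{..<m}"]
    by (intro sum.cong refl) (simp add: power_mult_distrib field_simps)
  moreover have "\<dots> > 0" using m c by simp
  ultimately have "\<forall>\<^sub>F n in sequentially. (\<Sum>i<m. real ((c * l n i) choose c) / real n ^ c *
     (real c * (\<Sum>j<i. real (l n j) / real n) - k * (real i * (real c * (real (l n i) / real n) + 1 / real n))
       - \<rho> * ((\<Sum>j<i. real (l n j) / real n) + (real (l n i) / real n + 1 / real n) / 2))) > 0"
    by (intro order_tendstoD(1)) simp_all
  moreover have "\<forall>\<^sub>F n in sequentially. \<forall>i\<in>{..<m}. real (l n i) / real n > 0"
    by (intro eventually_ball_finite ballI order_tendstoD(1)[OF l_lim] p_pos) auto
  ultimately have "\<forall>\<^sub>F n in sequentially. D n > 0 \<and> (\<forall>i<m. l n i > 0)"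
    using eventually_gt_at_top[of 0]
  proof eventually_elim
    case (elim n)
    have "(\<Sum>i<m. real ((c * l n i) choose c) / real n ^ c *
     (real c * (\<Sum>j<i. real (l n j) / real n) - k * (real i * (real c * (real (l n i) / real n) + 1 / real n))
       - \<rho> * ((\<Sum>j<i. real (l n j) / real n) + (real (l n i) / real n + 1 / real n) / 2))) = D n / (real n ^ c * real n)"
      unfolding D_def sum_divide_distrib[where A = "{..<m}"]
      using elim(3) by (intro sum.cong refl) (simp add: sum_divide_distrib[symmetric] field_simps)
    moreover have "real n ^ c * real n > 0" using elim(3) by simp
    ultimately have "D n > 0" using elim(1) by (simp only: zero_less_divide_iff) linarith
    moreover have "\<forall>i<m. l n i > 0" using elim by (simp add: zero_less_divide_iff)
    ultimately show ?case by blast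
  qed
  then obtain n where n: "D n > 0" "\<And>i. i < m \<Longrightarrow> l n i > 0"
    using eventually_happens'[OF sequentially_bot] by blast
  show ?thesis
  proof (rule that[of m "l n"])
    \<comment> \<open>An empty sum would be 0, against the strict inequality
      \<open>m\<close>.\<close>
    show "m > 0" using m by (intro gr0I) simp
    have "D n = (\<Sum>i<m. real ((c * l n i) choose c) *
          ((\<Sum>j<i. real (c * l n j)) - k * (real i * (real (c * l n i) + 1)))) -
       \<rho> * (\<Sum>i<m. real ((c * l n i) choose c) * ((\<Sum>j<i. real (l n j)) + (real (l n i) + 1) / 2))"
      unfolding D_def sum_distrib_left[where A = "{..<m}"] sum_subtractf[symmetric]
      by (intro sum.cong refl) (simp add: sum_distrib_left[symmetric] algebra_simps)
    thus "((2 * real c / (real c + 1))\<^sup>2 - \<epsilon>) *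
       (\<Sum>i<m. real ((c * l n i) choose c) * ((\<Sum>j<i. real (l n j)) + (real (l n i) + 1) / 2))
     \<le> (\<Sum>i<m. real ((c * l n i) choose c) *
          ((\<Sum>j<i. real (c * l n j)) - (real c - 1) / (real c + 1) * (real i * (real (c * l n i) + 1))))"
      using n(1) unfolding \<rho>_def k_def by linarith
  qed (use n(2) l_anti in auto)
qed

section \<open>Assembly of the hypergraph and the two bounds\<close>

theorem theorem4p3:
  fixes c :: nat and \<epsilon> :: real
  assumes "c \<ge> 2" and "\<epsilon> > 0"
  shows "\<exists>V E. uniform_hypergraph c V E \<and> E \<noteq> {} \<and>
           mssc_opt V E \<ge> ((2 * real c / (real c + 1))^2 - \<epsilon>) * lp_opt V E"
proof -
  define \<rho> where "\<rho> = (2 * real c / (real c + 1))^2 - \<epsilon>"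
  obtain m l where m: "m > 0" and l: "\<And>i. i < m \<Longrightarrow> l i > 0" and anti: "\<And>i j. j \<le> i \<Longrightarrow> l i \<le> l j"
    and gap: "\<rho> * (\<Sum>i<m. real ((c * l i) choose c) * ((\<Sum>j<i. real (l j)) + (real (l i) + 1) / 2))
     \<le> (\<Sum>i<m. real ((c * l i) choose c) *
          ((\<Sum>j<i. real (c * l j)) - (real c - 1) / (real c + 1) * (real i * (real (c * l i) + 1))))"
      (is "\<rho> * ?LP \<le> ?INT")
    unfolding \<rho>_def by (rule integer_power_law_gap[OF assms]) blast
  \<comment> \<open>Tagging each vertex with its clique index by \<open>prod_encode\<close> makes
    the cliques disjoint sets of naturals.\<close>
  define Q where "Q i = (\<lambda>a. prod_encode (i, a)) ` {..<c * l i}" for i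
  have card_Q: "card (Q i) = c * l i" for i
    unfolding Q_def by (subst card_image) (auto simp: inj_on_def)
  have fin: "finite (Q i)" for i by (simp add: Q_def)
  have disj: "disjoint_family_on Q {..<m}" by (auto simp: disjoint_family_on_def Q_def)
  define V where "V = (\<Union>i<m. Q i)"
  define E where "E = (\<Union>i<m. k_subsets (Q i) c)"
  have int: "?INT \<le> mssc_opt V E"
    using mssc_opt_cliques_ge[OF disj fin, of c] assms anti by (simp add: card_Q V_def E_def)
  obtain x u where lp: "lp_feasible V E x u" "lp_obj V E u = ?LP"
    using lp_feasible_cliques[OF disj fin, of c l] assms l by (auto simp: card_Q V_def E_def)
  have "\<rho> * lp_opt V E \<le> mssc_opt V E"
  \<comment> \<open>An upper bound on \<open>lp_opt\<close> helps only for nonnegative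
    \<open>\<rho>\<close>; otherwise the signs of the two optima suffice.\<close>
  proof (cases "\<rho> \<ge> 0")
    case True
    hence "\<rho> * lp_opt V E \<le> \<rho> * ?LP"
      using lp_opt_le[OF lp(1)] lp(2) by (intro mult_left_mono) auto
    thus ?thesis using gap int by linarith
  next
    case False
    have "mssc_opt V E \<ge> 0"
      by (rule le_mssc_opt) (auto simp: V_def fin mssc_cost_def intro!: sum_nonneg)
    moreover have "\<rho> * lp_opt V E \<le> 0"
      using False lp_opt_nonneg[OF lp(1)] by (intro mult_nonpos_nonneg) auto
    ultimately show ?thesis by linarith
  qed
  moreover have "uniform_hypergraph c V E"
    using fin by (auto simp: uniform_hypergraph_def V_def E_def k_subsets_def)
  moreover have "E \<noteq> {}"
  proof -
    have "c \<le> card (Q 0)" using l[OF m] by (simp add: card_Q)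
    then obtain e where "e \<subseteq> Q 0" "card e = c"
      by (rule obtain_subset_with_card_n)
    thus ?thesis using m by (auto simp: E_def k_subsets_def)
  qed
  ultimately show ?thesis unfolding \<rho>_def by blast
qed

end
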